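(* Let $p\ge1$ and let $y_t=\varepsilon_t$, $t\ge1$, with $\varepsilon_t$ i.i.d. $\mathcal N_p(0,I_p)$ (no change). Let $\alpha\in(0,1)$ and $x_n(\alpha)=4\log(n)-\log(\alpha)$. Then, for each of the following choices of a statistic $\tilde S_{\tau,n}$ and a time-varying threshold $c_n(\alpha)$, $$\mathbb P\big(\exists\,\tau<n\in\mathbb N\ \text{such that}\ \tilde S_{\tau,n}\ge c_n(\alpha)\big)\le\alpha:$$ 1. $\tilde S_{\tau,n}=S^{\#1}_{\tau,n}$ and $c_n(\alpha)=2x_n(\alpha)+2\log(2p)$; 2. $\tilde S_{\tau,n}=S^{\#s}_{\tau,n}$ with $1\le s\le p$ and $c_n(\alpha)=2\big(x_n(\alpha)+\log\binom ps\big)+2\sqrt{s\big(x_n(\alpha)+\log\binom ps\big)}+s$; 3. $\tilde S_{\tau,n}=S^{(a)}_{\tau,n}$ with $a\ge0$ and $c_n(\alpha)=4x_n(\alpha)+6p\,e^{-a^2/8}$. This holds both for the statistics with known pre-change mean $0$ and for those with unknown pre-change mean.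
   Context: Here $\tau,n$ range over integers with $1\le\tau<n$. For each coordinate $i\in\{1,\dots,p\}$ the evidence for a change at $\tau$ at time $n$ is, with known pre-change mean $0$, $$O^i_{\tau,n}(0)=\frac1{\sqrt{n-\tau}}\sum_{t=\tau+1}^n y^i_t,$$ and, with unknown pre-change mean, $$O^i_{\tau,n}(.)=\sqrt{\frac{\tau(n-\tau)}{n}}\Big(\frac1{n-\tau}\sum_{t=\tau+1}^n y_t^i-\frac1\tau\sum_{t=1}^\tau y_t^i\Big).$$ In either case, write $O^i_{\tau,n}$. The ranked statistic $S^{\#s}_{\tau,n}$ is the sum of the $s$ largest values among $(O^1_{\tau,n})^2,\dots,(O^p_{\tau,n})^2$. The thresholded statistic is $S^{(a)}_{\tau,n}=\sum_{i=1}^p(O^i_{\tau,n})^2\,\mathbb 1_{|O^i_{\tau,n}|\ge a}$. *)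

theory Defs
  imports "HOL-Probability.Probability" "HOL-Library.Multiset"
begin

(* Lebesgue density of the Gaussian law with mean 0 and identity covariance. *)
definition std_gaussian_density :: "'v::euclidean_space \<Rightarrow> real" where
  "std_gaussian_density x = exp (- (norm x)\<^sup>2 / 2) / sqrt (2 * pi) ^ DIM('v)"

(* Times start at 1: y 0 is never used below.
   Both evidence functions are only meaningful for 1 \<le> \<tau> < n. *)
definition evidence_known_mean ::
    "(nat \<Rightarrow> real ^ 'p) \<Rightarrow> nat \<Rightarrow> nat \<Rightarrow> 'p::finite \<Rightarrow> real" where
  "evidence_known_mean y \<tau> n i =
     1 / sqrt (real n - real \<tau>) * (\<Sum>t = \<tau> + 1..n. y t $ i)"

definition evidence_unknown_mean ::
    "(nat \<Rightarrow> real ^ 'p) \<Rightarrow> nat \<Rightarrow> nat \<Rightarrow> 'p::finite \<Rightarrow> real" where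
  "evidence_unknown_mean y \<tau> n i =
     sqrt (real \<tau> * (real n - real \<tau>) / real n) *
       (1 / (real n - real \<tau>) * (\<Sum>t = \<tau> + 1..n. y t $ i)
        - 1 / real \<tau> * (\<Sum>t = 1..\<tau>. y t $ i))"

(* The squares are collected in a multiset, so that ties are counted with multiplicity. *)
definition ranked_statistic :: "nat \<Rightarrow> ('p::finite \<Rightarrow> real) \<Rightarrow> real" where
  "ranked_statistic s z =
     sum_list (take s (rev (sorted_list_of_multiset
       (image_mset (\<lambda>i. (z i)\<^sup>2) (mset_set UNIV)))))"

definition thresholded_statistic :: "real \<Rightarrow> ('p::finite \<Rightarrow> real) \<Rightarrow> real" where
  "thresholded_statistic a z = (\<Sum>i\<in>UNIV. (z i)\<^sup>2 * of_bool (\<bar>z i\<bar> \<ge> a))"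

definition x_level :: "real \<Rightarrow> nat \<Rightarrow> real" where
  "x_level \<alpha> n = 4 * ln (real n) - ln \<alpha>"

definition alarm_event ::
    "'a measure \<Rightarrow> ('a \<Rightarrow> nat \<Rightarrow> nat \<Rightarrow> real) \<Rightarrow> (nat \<Rightarrow> real) \<Rightarrow> 'a set" where
  "alarm_event M S c =
     {\<omega> \<in> space M. \<exists>\<tau> n. 1 \<le> \<tau> \<and> \<tau> < n \<and> S \<omega> \<tau> n \<ge> c n}"

(* Measurability is stated explicitly because measure M is 0 on non-measurable sets. *)
definition false_alarm_at_most ::
    "'a measure \<Rightarrow> ('a \<Rightarrow> nat \<Rightarrow> nat \<Rightarrow> real) \<Rightarrow> (nat \<Rightarrow> real) \<Rightarrow> real \<Rightarrow> bool" where
  "false_alarm_at_most M S c \<alpha> \<longleftrightarrow>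
     alarm_event M S c \<in> sets M \<and> measure M (alarm_event M S c) \<le> \<alpha>"

end

theory Submission
  imports Defs
begin

text \<open>For each pair \<open>\<tau> < n\<close> the evidence is a linear combination of the observations with
  weights of unit Euclidean norm, so its coordinates are independent standard normal variables.
  Chernoff bounds show that the statistic at \<open>(\<tau>, n)\<close> exceeds its threshold with probability at
  most \<open>exp (- x_n) = \<alpha> / n ^ 4\<close>: for the ranked statistics after a union bound over the subsets
  of size \<open>s\<close>, for the thresholded statistic with exponent \<open>1/4\<close>. A union bound over all pairs
  finishes the proof, because \<open>(n - 1) / n ^ 4 \<le> 1 / (n - 1) - 1 / n\<close> telescopes.\<close>

subsection \<open>Coordinates of standard Gaussian vectors\<close>

text \<open>The squared norm is the sum of the squared coordinates, so the exponential factorises.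
  Independence of the coordinates of one vector comes from this.\<close>

lemma std_gaussian_density_eq_prod:
  fixes x :: "real ^ 'p::finite"
  shows "std_gaussian_density x = (\<Prod>i\<in>UNIV. std_normal_density (x $ i))"
proof -
  have "(norm x)\<^sup>2 = (\<Sum>i\<in>UNIV. (x $ i)\<^sup>2)"
    unfolding power2_norm_eq_inner by (simp add: inner_vec_def power2_eq_square)
  then show ?thesis
    by (simp add: std_gaussian_density_def std_normal_density_def prod_dividef prod.distrib
        exp_sum[symmetric] sum_negf sum_divide_distrib[symmetric] power_one_over)
qed

text \<open>Tonelli's theorem in coordinates: \<open>nn_integral_lborel_prod\<close> runs over
  \<open>Basis\<close>, and the injection \<open>?e\<close> from indices to basis vectors translates
  it into a product over coordinates.\<close>

lemma nn_integral_lborel_vec_prod: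
  fixes f :: "'p::finite \<Rightarrow> real \<Rightarrow> ennreal"
  assumes "\<And>i. f i \<in> borel_measurable borel"
  shows "(\<integral>\<^sup>+x. (\<Prod>i\<in>UNIV. f i ((x :: real ^ 'p) $ i)) \<partial>lborel) = (\<Prod>i\<in>UNIV. \<integral>\<^sup>+t. f i t \<partial>lborel)"
proof -
  let ?e = "\<lambda>i::'p. axis i (1::real)"
  have inj: "inj ?e" by (auto simp: inj_on_def axis_eq_axis)
  have B: "(Basis :: (real ^ 'p) set) = range ?e" by (auto simp: Basis_vec_def)
  have [simp]: "inv ?e (?e i) = i" for i
    using inj by (rule inv_f_f)
  have "(\<Prod>i\<in>UNIV. f i (x $ i)) = (\<Prod>b\<in>Basis. f (inv ?e b) (x \<bullet> b))" for x :: "real ^ 'p"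
    unfolding B by (subst prod.reindex[OF inj]) (simp add: inner_axis)
  moreover have "(\<Prod>i\<in>UNIV. \<integral>\<^sup>+t. f i t \<partial>lborel) = (\<Prod>b\<in>(Basis :: (real ^ 'p) set). \<integral>\<^sup>+t. f (inv ?e b) t \<partial>lborel)"
    unfolding B by (subst prod.reindex[OF inj]) simp
  moreover have "(\<integral>\<^sup>+x. (\<Prod>b\<in>Basis. f (inv ?e b) ((x :: real ^ 'p) \<bullet> b)) \<partial>lborel)
      = (\<Prod>b\<in>(Basis :: (real ^ 'p) set). \<integral>\<^sup>+t. f (inv ?e b) t \<partial>lborel)"
    by (rule nn_integral_lborel_prod) (use assms in auto)
  ultimately show ?thesis
    by simp
qed

lemma borel_measurable_vec_component[measurable (raw)]:
  fixes f :: "'a \<Rightarrow> real ^ 'p::finite"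
  assumes "f \<in> borel_measurable M"
  shows "(\<lambda>x. f x $ i) \<in> borel_measurable M"
  using assms by (rule measurable_compose) simp

lemma nn_integral_normal_density: "\<sigma> > 0 \<Longrightarrow> (\<integral>\<^sup>+x. ennreal (normal_density \<mu> \<sigma> x) \<partial>lborel) = 1"
  by (simp add: nn_integral_eq_integral)

section \<open>Marginal laws and independence of Gaussian coordinates\<close>

context prob_space
begin

text \<open>The indicator of a box is a product over coordinates, as is the density, so Tonelli
  applies. Marginal laws and independence are both read off from this formula.\<close>

lemma std_gaussian_box_emeasure:
  fixes Y :: "'a \<Rightarrow> real ^ 'p::finite"
  assumes Y: "distributed M lborel Y (\<lambda>x. ennreal (std_gaussian_density x))"
    and A[measurable]: "\<And>i. A i \<in> sets borel"
  shows "emeasure M {\<omega> \<in> space M. \<forall>i. Y \<omega> $ i \<in> A i}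
    = (\<Prod>i\<in>UNIV. \<integral>\<^sup>+t. ennreal (std_normal_density t) * indicator (A i) t \<partial>lborel)"
proof -
  have [measurable]: "Y \<in> borel_measurable M"
    using Y by (auto simp: distributed_def)
  let ?g = "\<lambda>x :: real ^ 'p. \<Prod>i\<in>UNIV. indicator (A i) (x $ i) :: ennreal"
  have g: "?g \<in> borel_measurable lborel"
    by measurable
  have "emeasure M {\<omega> \<in> space M. \<forall>i. Y \<omega> $ i \<in> A i} = (\<integral>\<^sup>+\<omega>. indicator {\<omega> \<in> space M. \<forall>i. Y \<omega> $ i \<in> A i} \<omega> \<partial>M)"
    by (rule nn_integral_indicator[symmetric]) measurable
  also have "\<dots> = (\<integral>\<^sup>+\<omega>. ?g (Y \<omega>) \<partial>M)"
    by (rule nn_integral_cong) (auto simp: indicator_def prod.neutral)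
  also have "\<dots> = (\<integral>\<^sup>+x. ennreal (std_gaussian_density x) * ?g x \<partial>lborel)"
    by (rule distributed_nn_integral[OF Y g, symmetric])
  also have "\<dots> = (\<integral>\<^sup>+x. (\<Prod>i\<in>UNIV. ennreal (std_normal_density (x $ i)) * indicator (A i) (x $ i)) \<partial>lborel)"
    by (simp add: std_gaussian_density_eq_prod prod_ennreal[symmetric] prod.distrib)
  also have "\<dots> = (\<Prod>i\<in>UNIV. \<integral>\<^sup>+t. ennreal (std_normal_density t) * indicator (A i) t \<partial>lborel)"
    by (rule nn_integral_lborel_vec_prod) measurable
  finally show ?thesis .
qed

lemma std_gaussian_coord_emeasure:
  fixes Y :: "'a \<Rightarrow> real ^ 'p::finite"
  assumes Y: "distributed M lborel Y (\<lambda>x. ennreal (std_gaussian_density x))"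
    and B: "B \<in> sets borel"
  shows "emeasure M {\<omega> \<in> space M. Y \<omega> $ j \<in> B}
    = (\<integral>\<^sup>+t. ennreal (std_normal_density t) * indicator B t \<partial>lborel)"
proof -
  \<comment> \<open>A condition on coordinate \<open>j\<close> alone is a box whose other sides are
    the whole line; their factors are total masses 1.\<close>
  have "emeasure M {\<omega> \<in> space M. \<forall>i. Y \<omega> $ i \<in> (if i = j then B else UNIV)}
    = (\<Prod>i\<in>UNIV. \<integral>\<^sup>+t. ennreal (std_normal_density t) * indicator (if i = j then B else UNIV) t \<partial>lborel)"
    by (rule std_gaussian_box_emeasure[OF Y]) (use B in auto)
  also have "{\<omega> \<in> space M. \<forall>i. Y \<omega> $ i \<in> (if i = j then B else UNIV)} = {\<omega> \<in> space M. Y \<omega> $ j \<in> B}"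
    by (auto split: if_splits)
  also have "(\<Prod>i\<in>UNIV. \<integral>\<^sup>+t. ennreal (std_normal_density t) * indicator (if i = j then B else UNIV) t \<partial>lborel)
      = (\<integral>\<^sup>+t. ennreal (std_normal_density t) * indicator B t \<partial>lborel)"
    by (subst prod.remove[of _ j]) (auto simp: nn_integral_normal_density intro!: prod.neutral)
  finally show ?thesis .
qed

lemma distributed_std_gaussian_coord:
  fixes Y :: "'a \<Rightarrow> real ^ 'p::finite"
  assumes Y: "distributed M lborel Y (\<lambda>x. ennreal (std_gaussian_density x))"
  shows "distributed M lborel (\<lambda>\<omega>. Y \<omega> $ j) (\<lambda>t. ennreal (std_normal_density t))"
proof -
  have [measurable]: "Y \<in> borel_measurable M"
    using Y by (auto simp: distributed_def)
  have "distr M lborel (\<lambda>\<omega>. Y \<omega> $ j) = density lborel (\<lambda>t. ennreal (std_normal_density t))"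
  proof (rule measure_eqI)
    fix B assume "B \<in> sets (distr M lborel (\<lambda>\<omega>. Y \<omega> $ j))"
    then have B[measurable]: "B \<in> sets borel" by simp
    show "emeasure (distr M lborel (\<lambda>\<omega>. Y \<omega> $ j)) B = emeasure (density lborel (\<lambda>t. ennreal (std_normal_density t))) B"
      using std_gaussian_coord_emeasure[OF Y B, of j]
      by (simp add: emeasure_distr emeasure_density vimage_def Int_def conj_commute cong: conj_cong)
  qed simp
  then show ?thesis
    by (simp add: distributed_def)
qed

lemma std_gaussian_box_prob:
  fixes Y :: "'a \<Rightarrow> real ^ 'p::finite"
  assumes Y: "distributed M lborel Y (\<lambda>x. ennreal (std_gaussian_density x))"
    and A: "\<And>i. A i \<in> sets borel"
  shows "prob {\<omega> \<in> space M. \<forall>i. Y \<omega> $ i \<in> A i} = (\<Prod>i\<in>UNIV. prob {\<omega> \<in> space M. Y \<omega> $ i \<in> A i})"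
proof -
  have "ennreal (prob {\<omega> \<in> space M. \<forall>i. Y \<omega> $ i \<in> A i})
      = (\<Prod>i\<in>UNIV. ennreal (prob {\<omega> \<in> space M. Y \<omega> $ i \<in> A i}))"
    by (simp add: emeasure_eq_measure[symmetric] std_gaussian_box_emeasure[OF Y A]
        std_gaussian_coord_emeasure[OF Y A])
  then show ?thesis
    by (simp add: prod_ennreal prod_nonneg)
qed

text \<open>Independence across times is assumed; independence within one vector is the box formula.
  Together they give the product rule for the doubly indexed family.\<close>

lemma indep_vars_coords:
  fixes y :: "nat \<Rightarrow> 'a \<Rightarrow> real ^ 'p::finite"
  assumes indep: "indep_vars (\<lambda>_. borel) y T" and T: "finite T" "T \<noteq> {}"
    and gauss: "\<And>t. t \<in> T \<Longrightarrow> distributed M lborel (y t) (\<lambda>x. ennreal (std_gaussian_density x))"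
  shows "indep_vars (\<lambda>_. borel) (\<lambda>(t, i) \<omega>. y t \<omega> $ i) (T \<times> (UNIV :: 'p set))"
proof -
  have rv: "y t \<in> borel_measurable M" if "t \<in> T" for t
    using indep that by (auto simp: indep_vars_def)
  let ?X = "\<lambda>(t, i) \<omega>. y t \<omega> $ (i::'p)"
  have "prob (\<Inter>j\<in>T \<times> UNIV. ?X j -` A j \<inter> space M) = (\<Prod>j\<in>T \<times> UNIV. prob (?X j -` A j \<inter> space M))"
    if A: "A \<in> T \<times> UNIV \<rightarrow> sets borel" for A
  proof -
    \<comment> \<open>All constraints at time \<open>t\<close> are bundled into one Borel box, so
      that independence of the whole vectors can be applied.\<close>
    define B where "B t = {x :: real ^ 'p. \<forall>i. x $ i \<in> A (t, i)}" for t
    have A': "A (t, i) \<in> sets borel" if "t \<in> T" for t i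
      using A that by auto
    have B: "B t \<in> sets borel" if "t \<in> T" for t
    proof -
      note A'[OF that, measurable]
      have "{x \<in> space borel. \<forall>i. (x :: real ^ 'p) $ i \<in> A (t, i)} \<in> sets borel"
        by measurable
      then show ?thesis by (simp add: B_def)
    qed
    have "(\<Inter>j\<in>T \<times> UNIV. ?X j -` A j \<inter> space M) = (\<Inter>t\<in>T. y t -` B t \<inter> space M)"
      using T by (auto simp: B_def)
    also have "prob \<dots> = (\<Prod>t\<in>T. prob (y t -` B t \<inter> space M))"
      by (rule indep_varsD[OF indep T(2,1)]) (use B in auto)
    also have "\<dots> = (\<Prod>t\<in>T. \<Prod>i\<in>UNIV. prob (?X (t, i) -` A (t, i) \<inter> space M))"
    proof (rule prod.cong[OF refl])
      fix t assume t: "t \<in> T"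
      show "prob (y t -` B t \<inter> space M) = (\<Prod>i\<in>UNIV. prob (?X (t, i) -` A (t, i) \<inter> space M))"
        using std_gaussian_box_prob[OF gauss[OF t], of "\<lambda>i. A (t, i)"] A'[OF t]
        by (simp add: B_def vimage_def Int_def conj_commute)
    qed
    also have "\<dots> = (\<Prod>j\<in>T \<times> UNIV. prob (?X j -` A j \<inter> space M))"
      unfolding prod.cartesian_product by (simp add: case_prod_beta)
    finally show ?thesis .
  qed
  \<comment> \<open>The Borel sets are an intersection-stable generator of themselves containing the
    whole space, so for a finite family the product rule over the full index set suffices.\<close>
  then show ?thesis
    using T rv
    by (subst indep_vars_finite[where E = "\<lambda>_. sets borel"])
      (auto simp: Int_stable_def sets.sigma_sets_eq[of borel, simplified])
qed

text \<open>The combinations are taken over exactly the indices with nonzero weight, because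
  degenerate normal laws have no density.\<close>

lemma weighted_sum_std_normal:
  fixes y :: "nat \<Rightarrow> 'a \<Rightarrow> real ^ 'p::finite"
  assumes indep: "indep_vars (\<lambda>_. borel) y T" and T: "finite T" "T \<noteq> {}"
    and gauss: "\<And>t. t \<in> T \<Longrightarrow> distributed M lborel (y t) (\<lambda>x. ennreal (std_gaussian_density x))"
    and w: "\<And>t. t \<in> T \<Longrightarrow> w t \<noteq> 0" "(\<Sum>t\<in>T. (w t)\<^sup>2) = 1"
  shows "indep_vars (\<lambda>_. borel) (\<lambda>i \<omega>. \<Sum>t\<in>T. w t * y t \<omega> $ i) (UNIV :: 'p set)"
    and "distributed M lborel (\<lambda>\<omega>. \<Sum>t\<in>T. w t * y t \<omega> $ i) (\<lambda>x. ennreal (std_normal_density x))"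
proof -
  let ?X = "\<lambda>(t, i) \<omega>. y t \<omega> $ (i::'p)"
  \<comment> \<open>Coordinate \<open>i\<close> uses only the block \<open>T \<times> {i}\<close>;
    the blocks are disjoint, so functions of different blocks are independent.\<close>
  have "indep_vars (\<lambda>i. PiM (T \<times> {i}) (\<lambda>_. borel)) (\<lambda>i \<omega>. \<lambda>j\<in>T \<times> {i}. ?X j \<omega>) UNIV"
    by (rule indep_vars_restrict[OF indep_vars_coords[OF indep T gauss]]) (auto simp: disjoint_family_on_def)
  from indep_vars_compose2[OF this, of "\<lambda>i f. \<Sum>t\<in>T. w t * f (t, i)" "\<lambda>_. borel"]
  show "indep_vars (\<lambda>_. borel) (\<lambda>i \<omega>. \<Sum>t\<in>T. w t * y t \<omega> $ i) (UNIV :: 'p set)"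
    by simp
next
  have "distributed M lborel (\<lambda>\<omega>. \<Sum>t\<in>T. w t * y t \<omega> $ i) (normal_density (\<Sum>t\<in>T. 0) (sqrt (\<Sum>t\<in>T. \<bar>w t\<bar>\<^sup>2)))"
  proof (rule sum_indep_normal[OF T])
    show "indep_vars (\<lambda>_. borel) (\<lambda>t \<omega>. w t * y t \<omega> $ i) T"
      by (rule indep_vars_compose2[OF indep]) simp
    \<comment> \<open>The standard deviation must be positive, hence the absolute value of the
      nonzero weight.\<close>
    show "distributed M lborel (\<lambda>\<omega>. w t * y t \<omega> $ i) (normal_density 0 \<bar>w t\<bar>)" if "t \<in> T" for t
      using normal_density_affine[OF distributed_std_gaussian_coord[OF gauss[OF that], of i], of "w t" 0] w that
      by simp
  qed (use w in auto)
  then show "distributed M lborel (\<lambda>\<omega>. \<Sum>t\<in>T. w t * y t \<omega> $ i) (\<lambda>x. ennreal (std_normal_density x))"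
    by (simp add: w)
qed

end

subsection \<open>Tail bounds\<close>

text \<open>Completing the square turns the integrand into a constant times the normal density
  centred at \<open>l\<close>.\<close>

lemma nn_integral_std_normal_exp:
  "(\<integral>\<^sup>+t. ennreal (std_normal_density t) * ennreal (exp (l * t)) \<partial>lborel) = ennreal (exp (l\<^sup>2 / 2))"
proof -
  have "ennreal (std_normal_density t) * ennreal (exp (l * t))
      = ennreal (exp (l\<^sup>2 / 2)) * ennreal (normal_density l 1 t)" for t
    by (simp add: normal_density_def ennreal_mult'[symmetric] exp_add[symmetric] mult.assoc)
      (simp add: power2_eq_square field_simps)
  then show ?thesis
    by (simp add: nn_integral_cmult nn_integral_eq_integral)
qed

text \<open>The integrand is \<open>\<sigma>\<close> times the centred normal density of variance
  \<open>1 / (1 - 2 * l)\<close>, which is positive exactly because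
  \<open>l < 1 / 2\<close>.\<close>

lemma nn_integral_std_normal_exp_square:
  assumes "l < 1 / 2"
  shows "(\<integral>\<^sup>+t. ennreal (std_normal_density t) * ennreal (exp (l * t\<^sup>2)) \<partial>lborel) = ennreal (1 / sqrt (1 - 2 * l))"
proof -
  define \<sigma> where "\<sigma> = 1 / sqrt (1 - 2 * l)"
  have s: "\<sigma> > 0" "\<sigma>\<^sup>2 = 1 / (1 - 2 * l)"
    using assms by (auto simp: \<sigma>_def power_divide)
  have "exp (- t\<^sup>2 / 2) * exp (l * t\<^sup>2) = exp (- t\<^sup>2 / (2 * \<sigma>\<^sup>2))" for t
    using assms unfolding s exp_add[symmetric] by (simp add: field_simps)
  then have "std_normal_density t * exp (l * t\<^sup>2) = \<sigma> * normal_density 0 \<sigma> t" for t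
    using s(1) by (simp add: normal_density_def real_sqrt_mult mult.assoc)
  then have "ennreal (std_normal_density t) * ennreal (exp (l * t\<^sup>2))
      = ennreal \<sigma> * ennreal (normal_density 0 \<sigma> t)" for t
    using s(1) by (simp add: ennreal_mult'[symmetric])
  then show ?thesis
    using s(1) by (simp add: nn_integral_cmult nn_integral_eq_integral \<sigma>_def[symmetric])
qed

text \<open>The difference \<open>f\<close> of the two sides vanishes at 0 and has the nonnegative
  derivative \<open>2 * x^2 / (1 - 2 * x)^2\<close>.\<close>

lemma neg_half_ln_le:
  fixes l :: real
  assumes "0 \<le> l" "l < 1 / 2"
  shows "- ln (1 - 2 * l) / 2 \<le> l + l\<^sup>2 / (1 - 2 * l)"
proof -
  define f where "f l = l + l\<^sup>2 / (1 - 2 * l) + ln (1 - 2 * l) / 2" for l :: real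
  have "f 0 \<le> f l"
  proof (rule DERIV_nonneg_imp_nondecreasing[OF assms(1)])
    fix x :: real assume x: "0 \<le> x" "x \<le> l"
    with assms have p: "1 - 2 * x > 0" by simp
    have "(f has_real_derivative 1 + (2 * x * (1 - 2 * x) + 2 * x\<^sup>2) / (1 - 2 * x)\<^sup>2 - 1 / (1 - 2 * x)) (at x)"
      unfolding f_def using p by (auto intro!: derivative_eq_intros simp: power2_eq_square) (simp add: divide_simps, simp add: algebra_simps)
    moreover have "1 + (2 * x * (1 - 2 * x) + 2 * x\<^sup>2) / (1 - 2 * x)\<^sup>2 - 1 / (1 - 2 * x) = 2 * x\<^sup>2 / (1 - 2 * x)\<^sup>2"
      using p by (simp add: divide_simps) (simp add: power2_eq_square algebra_simps)
    ultimately show "\<exists>d. (f has_real_derivative d) (at x) \<and> 0 \<le> d"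
      by auto
  qed
  then show ?thesis
    by (simp add: f_def)
qed

text \<open>Replaces the exact moment generating function of a squared standard normal variable by a
  sub-gamma bound, whose Chernoff optimum has a closed form.\<close>

lemma inverse_sqrt_le_exp:
  fixes l :: real
  assumes "0 \<le> l" "l < 1 / 2"
  shows "1 / sqrt (1 - 2 * l) \<le> exp (l + l\<^sup>2 / (1 - 2 * l))"
proof -
  have "1 / sqrt (1 - 2 * l) = exp (- ln (1 - 2 * l) / 2)"
    using assms by (simp add: exp_minus ln_sqrt[symmetric] inverse_eq_divide)
  then show ?thesis
    using neg_half_ln_le[OF assms] by simp
qed

text \<open>The exponent \<open>l\<close> minimises the Chernoff bound for the threshold of Laurent and Massart.\<close>

lemma chi_square_exponent:
  fixes s u :: real
  assumes "s > 0" "u \<ge> 0"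
  defines "l \<equiv> sqrt u / (sqrt s + 2 * sqrt u)"
  shows "s * (l + l\<^sup>2 / (1 - 2 * l)) - l * (2 * u + 2 * sqrt (s * u) + s) = - u"
proof -
  \<comment> \<open>With \<open>a\<close> and \<open>b\<close> as variables everything is rational,
    and clearing denominators leaves a polynomial identity.\<close>
  define a b where "a = sqrt s" and "b = sqrt u"
  have ab: "a > 0" "b \<ge> 0" "s = a\<^sup>2" "u = b\<^sup>2" "sqrt (s * u) = a * b" "a + 2 * b > 0"
    using assms by (auto simp: a_def b_def real_sqrt_mult intro: add_pos_nonneg)
  have l: "l = b / (a + 2 * b)" by (simp add: l_def a_def b_def)
  have "1 - 2 * l = a / (a + 2 * b)"
    using ab by (simp add: l field_simps)
  then have q: "l\<^sup>2 / (1 - 2 * l) = b\<^sup>2 / (a * (a + 2 * b))"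
    using ab by (simp add: l power2_eq_square)
  show ?thesis
    unfolding q ab(5) unfolding ab(3,4) l using ab(1,2,6)
    by (simp add: divide_simps) (simp add: power2_eq_square algebra_simps)
qed

text \<open>Below the threshold the left side is 1. Above it, \<open>1/4 = 3/8 - 1/8\<close>, so the
  left side is at most the average of \<open>1\<close> and \<open>exp (3 / 8 * w)\<close> with
  weight \<open>exp (- w / 8)\<close> on the latter; that weight may be enlarged since
  \<open>a^2 \<le> w\<close>.\<close>

lemma thresholded_exp_le:
  fixes w a :: real
  assumes "w \<ge> 0"
  shows "exp (1 / 4 * (w * of_bool (a\<^sup>2 \<le> w))) \<le> 1 + exp (- a\<^sup>2 / 8) * (exp (3 / 8 * w) - 1)"
proof (cases "a\<^sup>2 \<le> w")
  case True
  have "exp (1 / 4 * w) = exp (- w / 8) * exp (3 / 8 * w)"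
    by (simp add: exp_add[symmetric])
  also have "\<dots> \<le> 1 + exp (- w / 8) * (exp (3 / 8 * w) - 1)"
    using assms by (simp add: right_diff_distrib)
  also have "\<dots> \<le> 1 + exp (- a\<^sup>2 / 8) * (exp (3 / 8 * w) - 1)"
    using True assms by (intro add_left_mono mult_right_mono) auto
  finally show ?thesis using True by simp
next
  case False
  then show ?thesis using assms by simp
qed

section \<open>Chernoff bounds for functions of independent normal variables\<close>

context prob_space
begin

lemma std_normal_abs_tail:
  assumes Z: "distributed M lborel Z (\<lambda>x. ennreal (std_normal_density x))" and v: "v \<ge> 0"
  shows "prob {\<omega> \<in> space M. v \<le> (Z \<omega>)\<^sup>2} \<le> 2 * exp (- v / 2)"
\<comment> \<open>The Chernoff parameter below is \<open>sqrt v\<close> and must be positive; at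
  \<open>v = 0\<close> the claimed bound is 2.\<close>
proof (cases "v = 0")
  case True
  then show ?thesis by (simp add: order_trans[OF prob_le_1])
next
  case False
  have [measurable]: "Z \<in> borel_measurable M"
    using Z by (auto simp: distributed_def)
  define r where "r = sqrt v"
  have r: "r > 0" "r\<^sup>2 = v" using False v by (auto simp: r_def)
  \<comment> \<open>The signs \<open>e = 1\<close> and \<open>e = -1\<close> give the two tails.
    Taking the Chernoff parameter equal to the level \<open>r\<close> minimises
    \<open>l^2 / 2 - l * r\<close> over \<open>l\<close>.\<close>
  have half: "prob {\<omega> \<in> space M. r \<le> e * Z \<omega>} \<le> exp (- v / 2)" if e: "e\<^sup>2 = 1" for e
  proof -
    have "(\<integral>\<^sup>+\<omega>. ennreal (exp (r * (e * Z \<omega>))) \<partial>M) = ennreal (exp ((r * e)\<^sup>2 / 2))"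
      using distributed_nn_integral[OF Z, of "\<lambda>t. ennreal (exp ((r * e) * t))"]
      by (simp add: nn_integral_std_normal_exp flip: mult.assoc)
    then have "emeasure M {\<omega> \<in> space M. r \<le> e * Z \<omega>} \<le> ennreal (exp (- r * r)) * ennreal (exp (v / 2))"
      using Chernoff_ineq_nn_integral_ge[of r "space M" M "\<lambda>\<omega>. e * Z \<omega>" r] r e
      by (simp add: power_mult_distrib)
    also have "\<dots> = ennreal (exp (- v / 2))"
      using r by (simp add: ennreal_mult'[symmetric] exp_add[symmetric] power2_eq_square)
    finally show ?thesis by (simp add: emeasure_eq_measure)
  qed
  have "{\<omega> \<in> space M. v \<le> (Z \<omega>)\<^sup>2} \<subseteq> {\<omega> \<in> space M. r \<le> 1 * Z \<omega>} \<union> {\<omega> \<in> space M. r \<le> (-1) * Z \<omega>}"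
  proof safe
    fix \<omega> assume "v \<le> (Z \<omega>)\<^sup>2" "\<not> r \<le> -1 * Z \<omega>"
    then show "r \<le> 1 * Z \<omega>"
      using r real_le_rsqrt[of r] abs_le_square_iff[of r "Z \<omega>"] by auto
  qed
  then have "prob {\<omega> \<in> space M. v \<le> (Z \<omega>)\<^sup>2}
      \<le> prob ({\<omega> \<in> space M. r \<le> 1 * Z \<omega>} \<union> {\<omega> \<in> space M. r \<le> (-1) * Z \<omega>})"
    by (intro finite_measure_mono) measurable
  also have "\<dots> \<le> prob {\<omega> \<in> space M. r \<le> 1 * Z \<omega>} + prob {\<omega> \<in> space M. r \<le> (-1) * Z \<omega>}"
    by (intro measure_Un_le) measurable
  also have "\<dots> \<le> 2 * exp (- v / 2)"
    using half[of 1] half[of "-1"] by simp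
  finally show ?thesis .
qed

text \<open>Independence factors the exponential moment of the sum. Only an upper bound
  \<open>K\<close> on each logarithmic moment enters, so the chi-square and the thresholded sums are
  both covered.\<close>

lemma Chernoff_indep_sum:
  fixes X :: "'i \<Rightarrow> 'a \<Rightarrow> real"
  assumes T: "finite T" and indep: "indep_vars (\<lambda>_. borel) X T"
    and l: "l > 0" and mgf: "\<And>i. i \<in> T \<Longrightarrow> (\<integral>\<^sup>+\<omega>. ennreal (exp (l * X i \<omega>)) \<partial>M) \<le> ennreal (exp K)"
  shows "prob {\<omega> \<in> space M. c \<le> (\<Sum>i\<in>T. X i \<omega>)} \<le> exp (real (card T) * K - l * c)"
proof -
  have rv: "X i \<in> borel_measurable M" if "i \<in> T" for i
    using indep that by (auto simp: indep_vars_def)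
  have "emeasure M {\<omega> \<in> space M. c \<le> (\<Sum>i\<in>T. X i \<omega>)}
      \<le> ennreal (exp (- l * c)) * (\<integral>\<^sup>+\<omega>. ennreal (exp (l * (\<Sum>i\<in>T. X i \<omega>))) \<partial>M)"
    using Chernoff_ineq_nn_integral_ge[of l "space M" M "\<lambda>\<omega>. \<Sum>i\<in>T. X i \<omega>" c] l rv by simp
  also have "(\<integral>\<^sup>+\<omega>. ennreal (exp (l * (\<Sum>i\<in>T. X i \<omega>))) \<partial>M) = (\<integral>\<^sup>+\<omega>. (\<Prod>i\<in>T. ennreal (exp (l * X i \<omega>))) \<partial>M)"
    using T by (simp add: sum_distrib_left exp_sum prod_ennreal)
  also have "\<dots> = (\<Prod>i\<in>T. \<integral>\<^sup>+\<omega>. ennreal (exp (l * X i \<omega>)) \<partial>M)"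
    by (intro indep_vars_nn_integral T indep_vars_compose2[OF indep]) auto
  also have "ennreal (exp (- l * c)) * \<dots> \<le> ennreal (exp (- l * c)) * (\<Prod>i\<in>T. ennreal (exp K))"
    by (intro mult_left_mono prod_mono_ennreal mgf) auto
  also have "\<dots> = ennreal (exp (real (card T) * K - l * c))"
    by (simp add: ennreal_power ennreal_mult'[symmetric] exp_of_nat_mult[symmetric] exp_add[symmetric])
  finally show ?thesis
    by (simp add: emeasure_eq_measure)
qed

text \<open>The Laurent-Massart bound for a chi-square variable with \<open>card T\<close> degrees
  of freedom: the sub-gamma bound on each summand at the optimal exponent \<open>l\<close>.\<close>

lemma chi_square_tail:
  fixes Z :: "'i \<Rightarrow> 'a \<Rightarrow> real"
  assumes T: "finite T" "T \<noteq> {}" and indep: "indep_vars (\<lambda>_. borel) Z T"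
    and Z: "\<And>i. i \<in> T \<Longrightarrow> distributed M lborel (Z i) (\<lambda>x. ennreal (std_normal_density x))"
    and u: "u \<ge> 0"
  shows "prob {\<omega> \<in> space M. 2 * u + 2 * sqrt (real (card T) * u) + real (card T) \<le> (\<Sum>i\<in>T. (Z i \<omega>)\<^sup>2)} \<le> exp (- u)"
\<comment> \<open>At \<open>u = 0\<close> the exponent \<open>l\<close> would vanish, and the bound
  is trivially 1.\<close>
proof (cases "u = 0")
  case True
  then show ?thesis by simp
next
  case False
  define s where "s = real (card T)"
  have s: "s > 0" using T by (simp add: s_def card_gt_0_iff)
  define l where "l = sqrt u / (sqrt s + 2 * sqrt u)"
  have l: "0 < l" "l < 1 / 2"
    using False u s add_pos_pos[of "sqrt s" "2 * sqrt u"] by (auto simp: l_def divide_less_eq)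
  have "prob {\<omega> \<in> space M. 2 * u + 2 * sqrt (s * u) + s \<le> (\<Sum>i\<in>T. (Z i \<omega>)\<^sup>2)}
      \<le> exp (real (card T) * (l + l\<^sup>2 / (1 - 2 * l)) - l * (2 * u + 2 * sqrt (s * u) + s))"
  proof (rule Chernoff_indep_sum[OF T(1) _ l(1)])
    show "indep_vars (\<lambda>_. borel) (\<lambda>i \<omega>. (Z i \<omega>)\<^sup>2) T"
      by (rule indep_vars_compose2[OF indep]) simp
    show "(\<integral>\<^sup>+\<omega>. ennreal (exp (l * (Z i \<omega>)\<^sup>2)) \<partial>M) \<le> ennreal (exp (l + l\<^sup>2 / (1 - 2 * l)))" if "i \<in> T" for i
      using distributed_nn_integral[OF Z[OF that], of "\<lambda>t. ennreal (exp (l * t\<^sup>2))"]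
        nn_integral_std_normal_exp_square[OF l(2)] ennreal_leI[OF inverse_sqrt_le_exp[of l]] l
      by simp
  qed
  also have "\<dots> = exp (- u)"
    using chi_square_exponent[OF s u] by (simp add: s_def[symmetric] l_def[symmetric])
  finally show ?thesis by (simp add: s_def)
qed

text \<open>Integrates the pointwise bound: since \<open>exp (3 / 8 * Z^2)\<close> has expectation
  \<open>1 / sqrt (1 - 3 / 4) = 2\<close>, the result is at most \<open>1 + q\<close>, hence at most
  \<open>exp q\<close>.\<close>

lemma thresholded_mgf:
  assumes Z: "distributed M lborel Z (\<lambda>x. ennreal (std_normal_density x))"
  shows "(\<integral>\<^sup>+\<omega>. ennreal (exp (1 / 4 * ((Z \<omega>)\<^sup>2 * of_bool (a\<^sup>2 \<le> (Z \<omega>)\<^sup>2)))) \<partial>M) \<le> ennreal (exp (exp (- a\<^sup>2 / 8)))"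
proof -
  define q where "q = exp (- a\<^sup>2 / 8)"
  have q: "0 \<le> q" "q \<le> 1" by (auto simp: q_def)
  have [measurable]: "Z \<in> borel_measurable M"
    using Z by (auto simp: distributed_def)
  have E: "(\<integral>\<^sup>+\<omega>. ennreal (exp (3 / 8 * (Z \<omega>)\<^sup>2)) \<partial>M) = 2"
    using distributed_nn_integral[OF Z, of "\<lambda>t. ennreal (exp (3 / 8 * t\<^sup>2))"]
      nn_integral_std_normal_exp_square[of "3 / 8"]
    by (simp add: real_sqrt_divide)
  \<comment> \<open>The pointwise bound is regrouped with the nonnegative weights
    \<open>1 - q\<close> and \<open>q\<close>, so that no subtraction occurs in
    \<open>ennreal\<close>.\<close>
  have "(\<integral>\<^sup>+\<omega>. ennreal (exp (1 / 4 * ((Z \<omega>)\<^sup>2 * of_bool (a\<^sup>2 \<le> (Z \<omega>)\<^sup>2)))) \<partial>M)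
      \<le> (\<integral>\<^sup>+\<omega>. ennreal (1 - q) + ennreal q * ennreal (exp (3 / 8 * (Z \<omega>)\<^sup>2)) \<partial>M)"
  proof (rule nn_integral_mono)
    fix \<omega>
    show "ennreal (exp (1 / 4 * ((Z \<omega>)\<^sup>2 * of_bool (a\<^sup>2 \<le> (Z \<omega>)\<^sup>2))))
      \<le> ennreal (1 - q) + ennreal q * ennreal (exp (3 / 8 * (Z \<omega>)\<^sup>2))"
    proof -
      have "exp (1 / 4 * ((Z \<omega>)\<^sup>2 * of_bool (a\<^sup>2 \<le> (Z \<omega>)\<^sup>2))) \<le> (1 - q) + q * exp (3 / 8 * (Z \<omega>)\<^sup>2)"
        using thresholded_exp_le[OF zero_le_power2, of "Z \<omega>" a] unfolding q_def[symmetric] right_diff_distrib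
        by linarith
      from ennreal_leI[OF this] show ?thesis
        using q by (simp only: ennreal_mult' ennreal_plus diff_ge_0_iff_ge mult_nonneg_nonneg exp_ge_zero)
    qed
  qed
  also have "\<dots> = ennreal (1 - q) + ennreal q * 2"
    by (simp add: nn_integral_add nn_integral_cmult E[simplified] emeasure_space_1)
  also have "\<dots> = ennreal (1 + q)"
    using q by (simp add: ennreal_mult'[symmetric] ennreal_plus[symmetric] ennreal_numeral[symmetric]
        del: ennreal_plus ennreal_numeral)
  also have "\<dots> \<le> ennreal (exp q)"
    using exp_ge_add_one_self[of q] by (simp add: ennreal_leI)
  finally show ?thesis by (simp add: q_def)
qed

lemma thresholded_sum_tail:
  fixes Z :: "'i \<Rightarrow> 'a \<Rightarrow> real"
  assumes T: "finite T" and indep: "indep_vars (\<lambda>_. borel) Z T"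
    and Z: "\<And>i. i \<in> T \<Longrightarrow> distributed M lborel (Z i) (\<lambda>x. ennreal (std_normal_density x))"
  shows "prob {\<omega> \<in> space M. 4 * u + 6 * real (card T) * exp (- a\<^sup>2 / 8)
      \<le> (\<Sum>i\<in>T. (Z i \<omega>)\<^sup>2 * of_bool (a\<^sup>2 \<le> (Z i \<omega>)\<^sup>2))} \<le> exp (- u)" (is "?P \<le> _")
proof -
  have "?P \<le> exp (real (card T) * exp (- a\<^sup>2 / 8) - 1 / 4 * (4 * u + 6 * real (card T) * exp (- a\<^sup>2 / 8)))"
    by (intro Chernoff_indep_sum T indep_vars_compose2[OF indep] thresholded_mgf Z) auto
  \<comment> \<open>A quarter of the threshold is \<open>u\<close> plus 3/2 of the moment term,
    which therefore is absorbed.\<close>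
  also have "\<dots> \<le> exp (- u)"
    by (simp add: field_simps)
  finally show ?thesis .
qed

end

subsection \<open>Change-point statistics\<close>

text \<open>The sum of the \<open>s\<close> largest squares is the maximum over index sets of size
  \<open>s\<close>. An exceedance is thus a finite union of events about plain sums, which gives
  measurability and a union bound.\<close>

lemma ranked_statistic_ge_iff:
  fixes z :: "'p::finite \<Rightarrow> real"
  assumes s: "s \<le> CARD('p)"
  shows "c \<le> ranked_statistic s z \<longleftrightarrow> (\<exists>T. card T = s \<and> c \<le> (\<Sum>i\<in>T. (z i)\<^sup>2))"
proof -
  define f where "f i = (z i)\<^sup>2" for i
  obtain xs :: "'p list" where xs: "set xs = UNIV" "distinct xs"
    using finite_distinct_list[of "UNIV :: 'p set"] by auto
  \<comment> \<open>Indices are sorted instead of values, so that the largest squares belong to a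
    definite index set even when there are ties.\<close>
  define ks where "ks = rev (sort_key f xs)"
  have ks: "set ks = UNIV" "distinct ks" "length ks = CARD('p)"
    using xs distinct_card[of xs] by (auto simp: ks_def)
  have desc: "sorted_wrt (\<lambda>i j. f j \<le> f i) ks"
    using sorted_sort_key[of f xs] by (simp add: ks_def sorted_wrt_rev sorted_wrt_map)
  have "mset_set (UNIV :: 'p set) = mset xs"
    using xs mset_set_set by metis
  then have "rev (sorted_list_of_multiset (image_mset f (mset_set UNIV))) = rev (sort (map f xs))"
    by (simp flip: mset_map)
  also have "sort (map f xs) = map f (sort_key f xs)"
    by (rule properties_for_sort) auto
  finally have *: "rev (sorted_list_of_multiset (image_mset f (mset_set UNIV))) = map f ks"
    by (simp add: ks_def rev_map)
  define T0 where "T0 = set (take s ks)"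
  have T0: "card T0 = s" "ranked_statistic s z = sum f T0"
    using s ks * unfolding ranked_statistic_def T0_def f_def[symmetric]
    by (auto simp: distinct_card take_map sum_list_distinct_conv_sum_set)
  have top: "f j \<le> f i" if "i \<in> T0" "j \<notin> T0" for i j
  proof -
    have "j \<in> set (drop s ks)"
      using that ks(1) by (metis T0_def UNIV_I Un_iff append_take_drop_id set_append)
    moreover have "sorted_wrt (\<lambda>i j. f j \<le> f i) (take s ks @ drop s ks)"
      using desc by (simp only: append_take_drop_id)
    ultimately show ?thesis
      using that(1) unfolding sorted_wrt_append T0_def by blast
  qed
  have "sum f T \<le> sum f T0" if T: "card T = s" for T
  proof -
    have card: "card (T - T0) = card (T0 - T)"
      using T T0(1) by (simp add: card_Diff_subset_Int Int_commute)
    \<comment> \<open>Exchange argument: \<open>g\<close> trades each index of \<open>T\<close>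
      outside \<open>T0\<close> for one of \<open>T0\<close> outside \<open>T\<close>, whose square
      is at least as large.\<close>
    obtain g where g: "bij_betw g (T - T0) (T0 - T)"
      using finite_same_card_bij[OF finite finite card] by blast
    have "sum f (T - T0) \<le> (\<Sum>i\<in>T - T0. f (g i))"
      using g by (intro sum_mono top) (auto dest: bij_betwE)
    also have "\<dots> = sum f (T0 - T)"
      by (rule sum.reindex_bij_betw[OF g])
    finally show ?thesis
      using sum.Int_Diff[of T f T0] sum.Int_Diff[of T0 f T] by (simp add: Int_commute)
  qed
  then show ?thesis
    using T0 unfolding f_def[symmetric] by (auto intro: order_trans)
qed

section \<open>Union bound over all pairs of times\<close>

lemma exp_neg_x_level: "0 < \<alpha> \<Longrightarrow> n \<ge> 1 \<Longrightarrow> exp (- x_level \<alpha> n) = \<alpha> / real n ^ 4"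
  using exp_of_nat_mult[of 4 "ln (real n)"] by (simp add: x_level_def exp_diff)

lemma x_level_nonneg: "0 < \<alpha> \<Longrightarrow> \<alpha> < 1 \<Longrightarrow> n \<ge> 1 \<Longrightarrow> 0 \<le> x_level \<alpha> n"
  using ln_ge_zero[of "real n"] ln_less_zero[of \<alpha>] unfolding x_level_def by linarith

context prob_space
begin

lemma false_alarm_at_mostI:
  assumes \<alpha>: "0 < \<alpha>"
    and meas: "\<And>\<tau> n. 1 \<le> \<tau> \<Longrightarrow> \<tau> < n \<Longrightarrow> {\<omega> \<in> space M. c n \<le> S \<omega> \<tau> n} \<in> events"
    and tail: "\<And>\<tau> n. 1 \<le> \<tau> \<Longrightarrow> \<tau> < n \<Longrightarrow> prob {\<omega> \<in> space M. c n \<le> S \<omega> \<tau> n} \<le> exp (- x_level \<alpha> n)"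
  shows "false_alarm_at_most M S c \<alpha>"
proof -
  \<comment> \<open>The smallest time admitting a pair is 2, so \<open>E k\<close> gathers all
    alarms at time \<open>k + 2\<close>.\<close>
  define E where "E k = (\<Union>\<tau>\<in>{1..<k + 2}. {\<omega> \<in> space M. c (k + 2) \<le> S \<omega> \<tau> (k + 2)})" for k
  have alarm: "alarm_event M S c = (\<Union>k. E k)"
  proof safe
    fix \<omega> assume "\<omega> \<in> alarm_event M S c"
    then obtain \<tau> n where *: "\<omega> \<in> space M" "1 \<le> \<tau>" "\<tau> < n" "c n \<le> S \<omega> \<tau> n"
      by (auto simp: alarm_event_def)
    then have "n - 2 + 2 = n" by simp
    with * have "\<omega> \<in> E (n - 2)"
      unfolding E_def by auto
    then show "\<omega> \<in> (\<Union>k. E k)" by blast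
  next
    fix \<omega> k assume "\<omega> \<in> E k"
    then obtain \<tau> where "\<omega> \<in> space M" "1 \<le> \<tau>" "\<tau> < k + 2" "c (k + 2) \<le> S \<omega> \<tau> (k + 2)"
      by (auto simp: E_def)
    then show "\<omega> \<in> alarm_event M S c"
      unfolding alarm_event_def by blast
  qed
  have E: "range E \<subseteq> events"
    using meas by (auto simp: E_def intro!: sets.finite_UN)
  \<comment> \<open>With \<open>n = k + 2\<close> this is \<open>\<alpha> / (n - 1)\<close>; the
    telescoping series starts at \<open>g 0 = \<alpha>\<close> and so sums to exactly
    \<open>\<alpha>\<close>.\<close>
  define g where "g k = \<alpha> / (real k + 1)" for k
  have "g \<longlonglongrightarrow> 0"
    using tendsto_mult_right_zero[OF LIMSEQ_inverse_real_of_nat, of \<alpha>]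
    by (simp add: g_def[abs_def] divide_inverse add.commute)
  then have sums: "(\<lambda>k. g k - g (Suc k)) sums \<alpha>"
    using telescope_sums'[of g 0] by (simp add: g_def)
  have bound: "prob (E k) \<le> g k - g (Suc k)" for k
  proof -
    have "prob (E k) \<le> (\<Sum>\<tau>\<in>{1..<k + 2}. prob {\<omega> \<in> space M. c (k + 2) \<le> S \<omega> \<tau> (k + 2)})"
      unfolding E_def using meas by (intro finite_measure_subadditive_finite) auto
    also have "\<dots> \<le> (\<Sum>\<tau>\<in>{1..<k + 2}. exp (- x_level \<alpha> (k + 2)))"
      using tail by (intro sum_mono) auto
    also have "\<dots> = (real k + 1) * (\<alpha> / (real k + 2) ^ 4)"
      using \<alpha> by (simp add: exp_neg_x_level add.commute)
    also have "\<dots> \<le> \<alpha> / ((real k + 1) * (real k + 2))"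
    proof -
      \<comment> \<open>In terms of \<open>n = k + 2\<close> this is
        \<open>(n - 1)^2 \<le> n^3\<close>; multiplying by \<open>n\<close> gives the comparison
        with \<open>n^4\<close>.\<close>
      have "(real k + 1) * (real k + 1) \<le> (real k + 2) ^ 2 * (real k + 2)"
        by (simp add: power2_eq_square algebra_simps)
      then have "(real k + 1) * ((real k + 1) * (real k + 2)) \<le> (real k + 2) ^ 4"
        using mult_right_mono[of "(real k + 1) * (real k + 1)" "(real k + 2) ^ 2 * (real k + 2)" "real k + 2"]
        by (simp add: power2_eq_square power4_eq_xxxx mult.assoc)
      then have "(real k + 1) / (real k + 2) ^ 4 \<le> 1 / ((real k + 1) * (real k + 2))"
        by (simp add: divide_simps)
      from mult_left_mono[OF this less_imp_le[OF \<alpha>]] show ?thesis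
        by (simp only: times_divide_eq_right mult_1_right mult.commute)
    qed
    also have "\<dots> = g k - g (Suc k)"
      by (simp add: g_def divide_simps) (simp add: algebra_simps)
    finally show ?thesis .
  qed
  have summ: "summable (\<lambda>k. prob (E k))"
    by (rule summable_comparison_test'[OF sums_summable[OF sums], of 0]) (use bound in simp)
  have "prob (\<Union>k. E k) \<le> (\<Sum>k. prob (E k))"
    by (rule finite_measure_subadditive_countably[OF E summ])
  also have "\<dots> \<le> (\<Sum>k. g k - g (Suc k))"
    by (rule suminf_le[OF bound summ sums_summable[OF sums]])
  also have "\<dots> = \<alpha>"
    using sums by (simp add: sums_iff)
  finally show ?thesis
    using E by (auto simp: false_alarm_at_most_def alarm)
qed

text \<open>Both forms of evidence are weighted sums with nonzero weights of unit Euclidean norm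
  over a finite set \<open>T\<close> of times, so they are treated together once \<open>T\<close>
  and \<open>w\<close> are found.\<close>

lemma evidence_std_normal:
  fixes y :: "nat \<Rightarrow> 'a \<Rightarrow> real ^ 'p::finite"
  assumes indep: "indep_vars (\<lambda>_. borel) y {1..}"
    and gauss: "\<And>t. t \<ge> 1 \<Longrightarrow> distributed M lborel (y t) (\<lambda>x. ennreal (std_gaussian_density x))"
    and Ob: "Ob \<in> {evidence_known_mean, evidence_unknown_mean}" and \<tau>: "1 \<le> \<tau>" "\<tau> < n"
  shows "indep_vars (\<lambda>_. borel) (\<lambda>i \<omega>. Ob (\<lambda>t. y t \<omega>) \<tau> n i) (UNIV :: 'p set)"
    and "distributed M lborel (\<lambda>\<omega>. Ob (\<lambda>t. y t \<omega>) \<tau> n i) (\<lambda>x. ennreal (std_normal_density x))"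
proof -
  define d where "d = real n - real \<tau>"
  have d: "d > 0" "real n = real \<tau> + d" "real \<tau> > 0"
    using \<tau> by (auto simp: d_def)
  have card: "real (card {\<tau> + 1..n}) = d"
    using \<tau> by (simp add: d_def)
  obtain T w where T: "T \<subseteq> {1..}" "finite T" "T \<noteq> {}"
    and w: "\<And>t. t \<in> T \<Longrightarrow> w t \<noteq> 0" "(\<Sum>t\<in>T. (w t)\<^sup>2) = 1"
    and eq: "\<And>x i. Ob x \<tau> n (i :: 'p) = (\<Sum>t\<in>T. w t * x t $ i)"
  proof (cases "Ob = evidence_known_mean")
    case True
    show ?thesis
    \<comment> \<open>Observations up to \<open>\<tau>\<close> have weight 0 here, so they are left
      out of \<open>T\<close>.\<close>
    proof (rule that[of "{\<tau> + 1..n}" "\<lambda>_. 1 / sqrt d"])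
      show "(\<Sum>t\<in>{\<tau> + 1..n}. (1 / sqrt d)\<^sup>2) = 1"
        using d card by (simp add: power_divide)
    qed (use \<tau> d in \<open>auto simp: True evidence_known_mean_def d_def[symmetric] sum_divide_distrib\<close>)
  next
    case False
    then have Ob: "Ob = evidence_unknown_mean" using Ob by simp
    \<comment> \<open>The squared weights add up to \<open>r^2 * (1 / \<tau> + 1 / d)\<close>, and
      \<open>1 / \<tau> + 1 / d = n / (\<tau> * d)\<close>, so this \<open>r\<close> normalises
      them.\<close>
    define r where "r = sqrt (real \<tau> * d / real n)"
    have r: "r \<noteq> 0" "r\<^sup>2 = real \<tau> * d / real n"
      using d by (auto simp: r_def)
    define w where "w t = (if t \<le> \<tau> then - r / real \<tau> else r / d)" for t
    have split: "(\<Sum>t=1..n. h t) = (\<Sum>t=1..\<tau>. h t) + (\<Sum>t=\<tau> + 1..n. h t)" for h :: "nat \<Rightarrow> real"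
      using \<tau> sum.ub_add_nat[of 1 \<tau> h "n - \<tau>"] by simp
    show ?thesis
    proof (rule that[of "{1..n}" w])
      have "(\<Sum>t=1..n. (w t)\<^sup>2) = (\<Sum>t=1..\<tau>. (r / real \<tau>)\<^sup>2) + (\<Sum>t=\<tau> + 1..n. (r / d)\<^sup>2)"
        unfolding split by (intro arg_cong2[of _ _ _ _ "(+)"] sum.cong) (auto simp: w_def)
      also have "\<dots> = real \<tau> * (r\<^sup>2 / (real \<tau>)\<^sup>2) + d * (r\<^sup>2 / d\<^sup>2)"
        using card by (simp add: power_divide)
      also have "\<dots> = 1"
        unfolding r(2) d(2) using d(1,3) by (simp add: divide_simps) (simp add: power2_eq_square algebra_simps)
      finally show "(\<Sum>t=1..n. (w t)\<^sup>2) = 1" .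
      show "Ob x \<tau> n i = (\<Sum>t=1..n. w t * x t $ i)" for x and i :: 'p
      proof -
        have "(\<Sum>t=1..n. w t * x t $ i) = (\<Sum>t=1..\<tau>. - r / real \<tau> * x t $ i) + (\<Sum>t=\<tau> + 1..n. r / d * x t $ i)"
          unfolding split by (intro arg_cong2[of _ _ _ _ "(+)"] sum.cong) (auto simp: w_def)
        then show ?thesis
          by (simp add: Ob evidence_unknown_mean_def d_def[symmetric] r_def[symmetric]
              sum_distrib_left[symmetric] sum_divide_distrib[symmetric] sum_negf right_diff_distrib)
      qed
    qed (use \<tau> d r in \<open>auto simp: w_def\<close>)
  qed
  have "indep_vars (\<lambda>_. borel) y T"
    by (rule indep_vars_subset[OF indep T(1)])
  moreover have "distributed M lborel (y t) (\<lambda>x. ennreal (std_gaussian_density x))" if "t \<in> T" for t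
    using gauss T(1) that by auto
  ultimately show "indep_vars (\<lambda>_. borel) (\<lambda>i \<omega>. Ob (\<lambda>t. y t \<omega>) \<tau> n i) (UNIV :: 'p set)"
    and "distributed M lborel (\<lambda>\<omega>. Ob (\<lambda>t. y t \<omega>) \<tau> n i) (\<lambda>x. ennreal (std_normal_density x))"
    unfolding eq using weighted_sum_std_normal[OF _ T(2,3) _ w] by auto
qed

text \<open>Union bound over the index sets of size \<open>s\<close>. The bound \<open>B\<close> is
  left open because the maximum uses the two-sided normal tail and general \<open>s\<close> the
  chi-square tail.\<close>

lemma ranked_statistic_event:
  fixes Z :: "'p::finite \<Rightarrow> 'a \<Rightarrow> real"
  assumes [measurable]: "\<And>i. Z i \<in> borel_measurable M" and s: "s \<le> CARD('p)"
    and bound: "\<And>T. card T = s \<Longrightarrow> prob {\<omega> \<in> space M. c \<le> (\<Sum>i\<in>T. (Z i \<omega>)\<^sup>2)} \<le> B"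
  shows "{\<omega> \<in> space M. c \<le> ranked_statistic s (\<lambda>i. Z i \<omega>)} \<in> events" (is "?E \<in> _")
    and "prob {\<omega> \<in> space M. c \<le> ranked_statistic s (\<lambda>i. Z i \<omega>)} \<le> real (CARD('p) choose s) * B"
proof -
  let ?A = "\<lambda>T. {\<omega> \<in> space M. c \<le> (\<Sum>i\<in>T. (Z i \<omega>)\<^sup>2)}"
  have eq: "?E = (\<Union>T\<in>{T. card T = s}. ?A T)"
    by (auto simp: ranked_statistic_ge_iff[OF s])
  show "?E \<in> events"
    unfolding eq by (intro sets.finite_UN) auto
  have "prob ?E \<le> (\<Sum>T | card T = s. prob (?A T))"
    unfolding eq by (intro finite_measure_subadditive_finite) auto
  also have "\<dots> \<le> (\<Sum>T\<in>{T :: 'p set. card T = s}. B)"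
    using bound by (intro sum_mono) auto
  also have "\<dots> = real (CARD('p) choose s) * B"
    using n_subsets[of "UNIV :: 'p set" s] by simp
  finally show "prob ?E \<le> real (CARD('p) choose s) * B" .
qed

end

section \<open>The three thresholds\<close>

theorem proposition8:
  fixes M :: "'a measure"
    and y :: "nat \<Rightarrow> 'a \<Rightarrow> real ^ 'p::finite"
    and \<alpha> :: real
  assumes "prob_space M"
    and "prob_space.indep_vars M (\<lambda>_. borel) y {1..}"
    and "\<And>t. t \<ge> 1 \<Longrightarrow>
      distributed M lborel (y t) (\<lambda>x. ennreal (std_gaussian_density x))"
    and "0 < \<alpha>" and "\<alpha> < 1"
  shows "\<forall>Ob \<in> {evidence_known_mean, evidence_unknown_mean}.
    false_alarm_at_most M
      (\<lambda>\<omega> \<tau> n. ranked_statistic 1 (Ob (\<lambda>t. y t \<omega>) \<tau> n))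
      (\<lambda>n. 2 * x_level \<alpha> n + 2 * ln (2 * real CARD('p))) \<alpha> \<and>
    (\<forall>s. 1 \<le> s \<and> s \<le> CARD('p) \<longrightarrow>
      false_alarm_at_most M
        (\<lambda>\<omega> \<tau> n. ranked_statistic s (Ob (\<lambda>t. y t \<omega>) \<tau> n))
        (\<lambda>n. 2 * (x_level \<alpha> n + ln (real (CARD('p) choose s)))
           + 2 * sqrt (real s * (x_level \<alpha> n + ln (real (CARD('p) choose s))))
           + real s) \<alpha>) \<and>
    (\<forall>a::real. a \<ge> 0 \<longrightarrow>
      false_alarm_at_most M
        (\<lambda>\<omega> \<tau> n. thresholded_statistic a (Ob (\<lambda>t. y t \<omega>) \<tau> n))
        (\<lambda>n. 4 * x_level \<alpha> n + 6 * real CARD('p) * exp (- a\<^sup>2 / 8)) \<alpha>)"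
proof
  interpret prob_space M by fact
  fix Ob :: "(nat \<Rightarrow> real ^ 'p) \<Rightarrow> nat \<Rightarrow> nat \<Rightarrow> 'p \<Rightarrow> real"
  assume Ob: "Ob \<in> {evidence_known_mean, evidence_unknown_mean}"
  let ?Z = "\<lambda>\<tau> n i \<omega>. Ob (\<lambda>t. y t \<omega>) \<tau> n i"
  have indep: "indep_vars (\<lambda>_. borel) (?Z \<tau> n) UNIV"
    and Z: "distributed M lborel (?Z \<tau> n i) (\<lambda>x. ennreal (std_normal_density x))"
    if "1 \<le> \<tau>" "\<tau> < n" for \<tau> n i
    using evidence_std_normal[OF assms(2,3) Ob that] by auto
  have rv: "?Z \<tau> n i \<in> borel_measurable M" if "1 \<le> \<tau>" "\<tau> < n" for \<tau> n i
    using indep[OF that] by (auto simp: indep_vars_def)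
  have x: "0 \<le> x_level \<alpha> n" if "1 \<le> \<tau>" "\<tau> < n" for \<tau> n :: nat
    using that assms by (intro x_level_nonneg) auto
  have p: "real CARD('p) \<ge> 1"
    by (simp add: Suc_leI)
  \<comment> \<open>Not an instance of the bound for general \<open>s\<close>: the threshold differs
    and comes from the normal tail.\<close>
  have maximum: "false_alarm_at_most M (\<lambda>\<omega> \<tau> n. ranked_statistic 1 (Ob (\<lambda>t. y t \<omega>) \<tau> n))
      (\<lambda>n. 2 * x_level \<alpha> n + 2 * ln (2 * real CARD('p))) \<alpha>"
  proof (rule false_alarm_at_mostI[OF assms(4)])
    fix \<tau> n :: nat assume t: "1 \<le> \<tau>" "\<tau> < n"
    let ?c = "2 * x_level \<alpha> n + 2 * ln (2 * real CARD('p))"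
    have "0 \<le> ln (2 * real CARD('p))" using p by (intro ln_ge_zero) linarith
    then have c: "0 \<le> ?c" using x[OF t] by linarith
    have one: "prob {\<omega> \<in> space M. ?c \<le> (\<Sum>i\<in>T. (?Z \<tau> n i \<omega>)\<^sup>2)} \<le> 2 * exp (- ?c / 2)"
      if "card T = 1" for T
      using std_normal_abs_tail[OF Z[OF t] c] that by (auto simp: card_1_singleton_iff)
    have s: "1 \<le> CARD('p)" by (simp add: Suc_leI)
    show "{\<omega> \<in> space M. ?c \<le> ranked_statistic 1 (Ob (\<lambda>t. y t \<omega>) \<tau> n)} \<in> events"
      by (rule ranked_statistic_event(1)[OF rv[OF t] s one])
    \<comment> \<open>The term \<open>ln (2 * real CARD('p))\<close> pays for the two tails and the
      \<open>CARD('p)\<close> coordinates.\<close>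
    have "exp (- ?c / 2) = exp (- x_level \<alpha> n) / (2 * real CARD('p))"
    proof -
      have "- ?c / 2 = - x_level \<alpha> n - ln (2 * real CARD('p))" by simp
      then show ?thesis using p by (simp only: exp_diff) simp
    qed
    then have "real (CARD('p) choose 1) * (2 * exp (- ?c / 2)) = exp (- x_level \<alpha> n)"
      using p by simp
    moreover have "prob {\<omega> \<in> space M. ?c \<le> ranked_statistic 1 (Ob (\<lambda>t. y t \<omega>) \<tau> n)}
        \<le> real (CARD('p) choose 1) * (2 * exp (- ?c / 2))"
      by (rule ranked_statistic_event(2)[OF rv[OF t] s one])
    ultimately show "prob {\<omega> \<in> space M. ?c \<le> ranked_statistic 1 (Ob (\<lambda>t. y t \<omega>) \<tau> n)} \<le> exp (- x_level \<alpha> n)"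
      by linarith
  qed
  have ranked: "false_alarm_at_most M (\<lambda>\<omega> \<tau> n. ranked_statistic s (Ob (\<lambda>t. y t \<omega>) \<tau> n))
      (\<lambda>n. 2 * (x_level \<alpha> n + ln (real (CARD('p) choose s)))
           + 2 * sqrt (real s * (x_level \<alpha> n + ln (real (CARD('p) choose s)))) + real s) \<alpha>"
    if s: "1 \<le> s" "s \<le> CARD('p)" for s
  proof (rule false_alarm_at_mostI[OF assms(4)])
    fix \<tau> n :: nat assume t: "1 \<le> \<tau>" "\<tau> < n"
    \<comment> \<open>The added logarithm of the number of index sets cancels the factor of the
      union bound.\<close>
    let ?u = "x_level \<alpha> n + ln (real (CARD('p) choose s))"
    let ?c = "2 * ?u + 2 * sqrt (real s * ?u) + real s"
    have b: "real (CARD('p) choose s) \<ge> 1" using s by (simp add: Suc_leI)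
    have u: "0 \<le> ?u" using x[OF t] b by simp
    have tail: "prob {\<omega> \<in> space M. ?c \<le> (\<Sum>i\<in>T. (?Z \<tau> n i \<omega>)\<^sup>2)} \<le> exp (- ?u)"
      if T: "card T = s" for T
    proof -
      have "T \<noteq> {}" using T s by auto
      from chi_square_tail[OF finite this indep_vars_subset[OF indep[OF t] subset_UNIV] Z[OF t] u]
      show ?thesis by (simp only: T)
    qed
    show "{\<omega> \<in> space M. ?c \<le> ranked_statistic s (Ob (\<lambda>t. y t \<omega>) \<tau> n)} \<in> events"
      by (rule ranked_statistic_event(1)[OF rv[OF t] s(2) tail])
    have "exp (- ?u) = exp (- x_level \<alpha> n) / real (CARD('p) choose s)"
    proof -
      have "- ?u = - x_level \<alpha> n - ln (real (CARD('p) choose s))" by simp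
      then show ?thesis using b s by (simp only: exp_diff) simp
    qed
    then have "real (CARD('p) choose s) * exp (- ?u) = exp (- x_level \<alpha> n)"
      using s by simp
    moreover have "prob {\<omega> \<in> space M. ?c \<le> ranked_statistic s (Ob (\<lambda>t. y t \<omega>) \<tau> n)}
        \<le> real (CARD('p) choose s) * exp (- ?u)"
      by (rule ranked_statistic_event(2)[OF rv[OF t] s(2) tail])
    ultimately show "prob {\<omega> \<in> space M. ?c \<le> ranked_statistic s (Ob (\<lambda>t. y t \<omega>) \<tau> n)} \<le> exp (- x_level \<alpha> n)"
      by linarith
  qed
  have thresholded: "false_alarm_at_most M (\<lambda>\<omega> \<tau> n. thresholded_statistic a (Ob (\<lambda>t. y t \<omega>) \<tau> n))
      (\<lambda>n. 4 * x_level \<alpha> n + 6 * real CARD('p) * exp (- a\<^sup>2 / 8)) \<alpha>"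
    if a: "0 \<le> a" for a :: real
  proof (rule false_alarm_at_mostI[OF assms(4)])
    fix \<tau> n :: nat assume t: "1 \<le> \<tau>" "\<tau> < n"
    let ?c = "4 * x_level \<alpha> n + 6 * real CARD('p) * exp (- a\<^sup>2 / 8)"
    \<comment> \<open>As \<open>a\<close> is nonnegative, the threshold on the absolute value is one
      on the square, the form used in the tail bound.\<close>
    have S: "thresholded_statistic a z = (\<Sum>i\<in>UNIV. (z i)\<^sup>2 * of_bool (a\<^sup>2 \<le> (z i)\<^sup>2))" for z :: "'p \<Rightarrow> real"
      using a by (simp add: thresholded_statistic_def abs_le_square_iff[symmetric])
    note rv[OF t, measurable]
    show "{\<omega> \<in> space M. ?c \<le> thresholded_statistic a (Ob (\<lambda>t. y t \<omega>) \<tau> n)} \<in> events"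
      unfolding S by measurable
    show "prob {\<omega> \<in> space M. ?c \<le> thresholded_statistic a (Ob (\<lambda>t. y t \<omega>) \<tau> n)} \<le> exp (- x_level \<alpha> n)"
      unfolding S by (rule thresholded_sum_tail[OF finite indep[OF t] Z[OF t]])
  qed
  show "false_alarm_at_most M
      (\<lambda>\<omega> \<tau> n. ranked_statistic 1 (Ob (\<lambda>t. y t \<omega>) \<tau> n))
      (\<lambda>n. 2 * x_level \<alpha> n + 2 * ln (2 * real CARD('p))) \<alpha> \<and>
    (\<forall>s. 1 \<le> s \<and> s \<le> CARD('p) \<longrightarrow>
      false_alarm_at_most M
        (\<lambda>\<omega> \<tau> n. ranked_statistic s (Ob (\<lambda>t. y t \<omega>) \<tau> n))
        (\<lambda>n. 2 * (x_level \<alpha> n + ln (real (CARD('p) choose s)))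
           + 2 * sqrt (real s * (x_level \<alpha> n + ln (real (CARD('p) choose s))))
           + real s) \<alpha>) \<and>
    (\<forall>a::real. a \<ge> 0 \<longrightarrow>
      false_alarm_at_most M
        (\<lambda>\<omega> \<tau> n. thresholded_statistic a (Ob (\<lambda>t. y t \<omega>) \<tau> n))
        (\<lambda>n. 4 * x_level \<alpha> n + 6 * real CARD('p) * exp (- a\<^sup>2 / 8)) \<alpha>)"
    using maximum ranked thresholded by blast
qed

end
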